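(* Let $t\geq 3$ be an integer and let $q$ be a prime power with $q\geq 2t-1$. Then there exists an MS$(q^{2t-1},t)$, i.e. a $t$-multimagic square of order $q^{2t-1}$.
   Context: An $n\times n$ integer matrix $A=(a_{i,j})$ is a general magic square if the sums of the entries in each row, each column, the main diagonal $\{a_{i,i}\}$ and the back diagonal $\{a_{i,n-1-i}\}$ are all equal. For a positive integer $t$, a general magic square $M=(m_{i,j})$ is a general $t$-multimagic square if for every $e=1,2,\dots,t$ the matrix $M^{*e}=(m_{i,j}^{e})$ (entrywise $e$-th power) is a general magic square. A general $t$-multimagic square of order $n$ whose $n^2$ entries are $n^2$ consecutive integers is called a $t$-multimagic square and denoted MS$(n,t)$. *)

theory Defs
  imports "HOL-Computational_Algebra.Primes"
begin

text \<open>An n x n integer matrix is represented as a function A :: nat => nat => int,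
  where only entries A i j with i < n and j < n are relevant.\<close>

definition general_magic_square :: "nat \<Rightarrow> (nat \<Rightarrow> nat \<Rightarrow> int) \<Rightarrow> bool" where
  "general_magic_square n A \<longleftrightarrow>
     (\<exists>s. (\<forall>i<n. (\<Sum>j<n. A i j) = s) \<and>
          (\<forall>j<n. (\<Sum>i<n. A i j) = s) \<and>
          (\<Sum>i<n. A i i) = s \<and>
          (\<Sum>i<n. A i (n - 1 - i)) = s)"

definition general_multimagic :: "nat \<Rightarrow> nat \<Rightarrow> (nat \<Rightarrow> nat \<Rightarrow> int) \<Rightarrow> bool" where
  "general_multimagic n t M \<longleftrightarrow>
     (\<forall>e\<in>{1..t}. general_magic_square n (\<lambda>i j. (M i j) ^ e))"

text \<open>MS(n,t): a general t-multimagic square whose n^2 entries are n^2 consecutive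
  integers, i.e. the entries form the set {a, ..., a + n^2 - 1} for some integer a
  (which, having n^2 elements, forces the entries to be pairwise distinct).\<close>
definition multimagic_square :: "nat \<Rightarrow> nat \<Rightarrow> (nat \<Rightarrow> nat \<Rightarrow> int) \<Rightarrow> bool" where
  "multimagic_square n t M \<longleftrightarrow>
     general_multimagic n t M \<and>
     (\<exists>a::int. (\<lambda>(i,j). M i j) ` ({..<n} \<times> {..<n}) = {a..a + int (n^2) - 1})"

definition prime_power :: "nat \<Rightarrow> bool" where
  "prime_power q \<longleftrightarrow> (\<exists>p k. prime p \<and> k \<ge> 1 \<and> q = p ^ k)"

end

theory Submission
  imports
    "HOL-Library.FuncSet"
    "HOL-Library.Cardinality"
    "HOL-Library.Product_Plus"
    "HOL-Algebra.Algebraic_Closure_Type"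
    "Berlekamp_Zassenhaus.Finite_Field"
    Defs
begin

hide_const (open) Divisibility.prime

text \<open>
  Index rows and columns by a vector space \<open>V\<close> of dimension \<open>2t - 1\<close> over the field with \<open>q\<close>
  elements, and let the \<open>2(2t - 1)\<close> base-\<open>q\<close> digits of the entry in row \<open>r\<close> and column \<open>c\<close> be
  linear forms in \<open>(r, c)\<close>. The \<open>e\<close>-th power of an entry expands into products of at most \<open>e\<close>
  distinct digits, so a line of the square has the right power sums up to exponent \<open>t\<close> as soon as
  its digits form an orthogonal array of strength \<open>t\<close>, that is, any \<open>t\<close> of the digit forms are
  independent on that line.

  A vector is a pair of polynomials \<open>(u, p)\<close> with \<open>deg u < t\<close> and \<open>deg p < t - 1\<close>; put
  \<open>w = X^t p + p(0)\<close>. Fix \<open>2t - 1\<close> points of the field and a scalar \<open>\<mu>\<close> different from \<open>0\<close>, \<open>1\<close>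
  and \<open>-1\<close>. The digits of the entry \<open>(r, c)\<close> are the values at these points of
  \<open>u_c + \<mu> u_r + w_c\<close> and of \<open>\<mu> u_c + u_r + \<mu> w_r\<close>. On rows, columns and both diagonals the two
  polynomials have, up to constants, the shape \<open>(\<alpha> u + \<gamma> w, \<beta> u + \<delta> w)\<close> with \<open>\<alpha>\<close>, \<open>\<beta>\<close> and
  \<open>\<alpha> \<delta> - \<beta> \<gamma>\<close> nonzero. Prescribing \<open>t\<close> digits then prescribes \<open>w\<close> at the at most \<open>t/2\<close> points
  where both digits are given, and after that \<open>u\<close> at no more than \<open>t\<close> points.
\<close>

section \<open>Orthogonal arrays\<close>

text \<open>Only equality of the counts is demanded, so the index of the array need not be
  named.\<close>

definition orthogonal_array :: "nat \<Rightarrow> 'i set \<Rightarrow> 'x set \<Rightarrow> ('x \<Rightarrow> 'i \<Rightarrow> 'a) \<Rightarrow> bool" where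
  "orthogonal_array t I Z D \<longleftrightarrow>
     (\<forall>K y z. K \<subseteq> I \<and> card K \<le> t \<longrightarrow>
        card {x\<in>Z. \<forall>i\<in>K. D x i = y i} = card {x\<in>Z. \<forall>i\<in>K. D x i = z i})"

text \<open>Grouping by the digits on \<open>K\<close> gives fibres of one size \<open>c\<close>,
  and the case \<open>G = 1\<close> identifies \<open>c\<close>; denominators are cleared to stay in
  the integers.\<close>

lemma sum_orthogonal_array:
  fixes D :: "'x \<Rightarrow> 'i \<Rightarrow> 'a::finite" and G :: "('i \<Rightarrow> 'a) \<Rightarrow> int"
  assumes D: "orthogonal_array t I Z D" and Z: "finite Z"
    and K: "K \<subseteq> I" "card K \<le> t" "finite K"
  shows "int (CARD('a)) ^ card K * (\<Sum>x\<in>Z. G (restrict (D x) K)) =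
           int (card Z) * (\<Sum>y\<in>K \<rightarrow>\<^sub>E UNIV. G y)"
proof -
  define P where "P = K \<rightarrow>\<^sub>E (UNIV :: 'a set)"
  have P: "finite P" "card P = CARD('a) ^ card K"
    using K by (auto simp: P_def card_PiE finite_PiE)
  define c where "c = card {x\<in>Z. \<forall>i\<in>K. D x i = undefined}"
  have fibre: "card {x\<in>Z. restrict (D x) K = y} = c" if "y \<in> P" for y
  proof -
    have "restrict (D x) K = y \<longleftrightarrow> (\<forall>i\<in>K. D x i = y i)" for x
      using that unfolding P_def by (metis PiE_restrict restrict_apply' restrict_ext)
    moreover have "card {x\<in>Z. \<forall>i\<in>K. D x i = y i} = c"
      using D[unfolded orthogonal_array_def, rule_format, of K y "\<lambda>_. undefined"] K
      by (simp add: c_def)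
    ultimately show ?thesis by simp
  qed
  have img: "(\<lambda>x. restrict (D x) K) ` Z \<subseteq> P"
    by (auto simp: P_def)
  have sum: "(\<Sum>x\<in>Z. F (restrict (D x) K)) = int c * (\<Sum>y\<in>P. F y)" for F :: "_ \<Rightarrow> int"
  proof -
    have "(\<Sum>x\<in>Z. F (restrict (D x) K)) =
        (\<Sum>y\<in>P. \<Sum>x\<in>{x\<in>Z. restrict (D x) K = y}. F (restrict (D x) K))"
      using sum.group[OF Z P(1) img, of "\<lambda>x. F (restrict (D x) K)"] by simp
    also have "\<dots> = (\<Sum>y\<in>P. int c * F y)"
      by (intro sum.cong) (auto simp flip: fibre)
    finally show ?thesis by (simp add: sum_distrib_left)
  qed
  from sum[of "\<lambda>_. 1"] have "int (card Z) = int c * int (CARD('a) ^ card K)"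
    using P by simp
  with sum[of G] show ?thesis
    by (simp add: P_def)
qed

text \<open>Each term of the expanded power, indexed by \<open>s\<close>, sees only the at most
  \<open>e\<close> digits in the image of \<open>s\<close>, so its sum over the array depends on the
  size of the array alone.\<close>

lemma moments_orthogonal_array_eq:
  fixes D :: "'x \<Rightarrow> 'i \<Rightarrow> 'a::finite" and D' :: "'y \<Rightarrow> 'i \<Rightarrow> 'a" and h :: "'i \<Rightarrow> 'a \<Rightarrow> int"
  assumes D: "orthogonal_array t I Z D" "orthogonal_array t I Y D'"
    and Z: "finite Z" "finite Y" "card Z = card Y" and I: "finite I" and e: "e \<le> t"
  shows "(\<Sum>x\<in>Z. (\<Sum>i\<in>I. h i (D x i)) ^ e) = (\<Sum>x\<in>Y. (\<Sum>i\<in>I. h i (D' x i)) ^ e)"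
proof -
  have power: "(\<Sum>i\<in>I. h i (d i)) ^ e = (\<Sum>s\<in>{..<e} \<rightarrow>\<^sub>E I. \<Prod>j<e. h (s j) (d (s j)))" for d
    using prod_sum_PiE[of "{..<e}" "\<lambda>_. I" "\<lambda>_ i. h i (d i)"] I by simp
  have "(\<Sum>x\<in>Z. \<Prod>j<e. h (s j) (D x (s j))) = (\<Sum>x\<in>Y. \<Prod>j<e. h (s j) (D' x (s j)))"
    if s: "s \<in> {..<e} \<rightarrow>\<^sub>E I" for s
  proof -
    define K where "K = s ` {..<e}"
    define G where "G = (\<lambda>y. \<Prod>j<e. h (s j) (y (s j)))"
    have K: "K \<subseteq> I" "finite K" "card K \<le> t"
      using s e card_image_le[of "{..<e}" s] by (auto simp: K_def)
    have G: "(\<Prod>j<e. h (s j) (d (s j))) = G (restrict d K)" for d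
      by (auto simp: G_def K_def)
    have "int CARD('a) ^ card K * (\<Sum>x\<in>Z. G (restrict (D x) K)) =
        int CARD('a) ^ card K * (\<Sum>x\<in>Y. G (restrict (D' x) K))"
      using sum_orthogonal_array[OF D(1) Z(1) K(1,3,2), of G]
            sum_orthogonal_array[OF D(2) Z(2) K(1,3,2), of G] Z(3) by simp
    then show ?thesis by (simp add: G)
  qed
  then show ?thesis
    unfolding power by (subst (1 2) sum.swap) (auto intro: sum.cong)
qed

text \<open>Translation by some \<open>d\<close> with \<open>L d = y - z\<close> on \<open>K\<close>
  matches the two fibres; the constants \<open>b\<close> cancel.\<close>

lemma orthogonal_array_affine:
  fixes L :: "'v::ab_group_add \<Rightarrow> 'i \<Rightarrow> 'a::ab_group_add"
  assumes V: "\<And>x y. x \<in> V \<Longrightarrow> y \<in> V \<Longrightarrow> x - y \<in> V"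
    and L: "\<And>x y i. L (x - y) i = L x i - L y i"
    and surj: "\<And>K y. K \<subseteq> I \<Longrightarrow> card K \<le> t \<Longrightarrow> \<exists>x\<in>V. \<forall>i\<in>K. L x i = y i"
    and D: "\<And>x i. x \<in> V \<Longrightarrow> i \<in> I \<Longrightarrow> D x i = L x i + b i"
  shows "orthogonal_array t I V D"
  unfolding orthogonal_array_def
proof (intro allI impI, elim conjE)
  fix K y z assume K: "K \<subseteq> I" "card K \<le> t"
  obtain d where d: "d \<in> V" "\<forall>i\<in>K. L d i = y i - z i"
    using surj[OF K, of "\<lambda>i. y i - z i"] by blast
  have DK: "D x i = L x i + b i" if "x \<in> V" "i \<in> K" for x i
    using D K that by auto
  \<comment> \<open>Only closure under differences is given, so \<open>x + d\<close> is reached as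
    \<open>x - ((d - d) - d)\<close>.\<close>
  have plus: "x + d \<in> V" if "x \<in> V" for x
    using V[OF that V[OF V[OF d(1) d(1)] d(1)]] by simp
  have Lplus: "L (x + d) i = L x i + L d i" for x i
    using L[of "x + d" d i] by simp
  show "card {x\<in>V. \<forall>i\<in>K. D x i = y i} = card {x\<in>V. \<forall>i\<in>K. D x i = z i}"
  proof (rule bij_betw_same_card[OF bij_betw_byWitness[where f = "\<lambda>x. x - d" and f' = "\<lambda>x. x + d"]])
    show "(\<lambda>x. x - d) ` {x\<in>V. \<forall>i\<in>K. D x i = y i} \<subseteq> {x\<in>V. \<forall>i\<in>K. D x i = z i}"
    proof safe
      fix x assume x: "x \<in> V" "\<forall>i\<in>K. D x i = y i"
      show "x - d \<in> V" using V x d by blast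
      fix i assume i: "i \<in> K"
      have "D (x - d) i = D x i - L d i"
        using DK[OF V[OF x(1) d(1)] i] DK[OF x(1) i] L by (simp add: algebra_simps)
      then show "D (x - d) i = z i"
        using x d i by simp
    qed
    show "(\<lambda>x. x + d) ` {x\<in>V. \<forall>i\<in>K. D x i = z i} \<subseteq> {x\<in>V. \<forall>i\<in>K. D x i = y i}"
    proof safe
      fix x assume x: "x \<in> V" "\<forall>i\<in>K. D x i = z i"
      show "x + d \<in> V" using plus x by blast
      fix i assume i: "i \<in> K"
      have "D (x + d) i = D x i + L d i"
        using DK[OF plus[OF x(1)] i] DK[OF x(1) i] unfolding Lplus by (simp add: algebra_simps)
      then show "D (x + d) i = y i"
        using x d i by simp
    qed
  qed auto
qed

section \<open>Base expansions and symmetric enumerations\<close>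

lemma sum_digits_mod:
  fixes q :: nat
  shows "(\<Sum>k<m. (x div q ^ k mod q) * q ^ k) = x mod q ^ m"
proof (induction m)
  case (Suc m)
  have "x mod q ^ Suc m = q ^ m * (x div q ^ m mod q) + x mod q ^ m"
    by (simp only: power_Suc2 mod_mult2_eq)
  with Suc show ?case by simp
qed simp

lemma sum_digits_less:
  fixes q :: nat
  assumes "\<And>k. k < m \<Longrightarrow> d k < q"
  shows "(\<Sum>k<m. d k * q ^ k) < q ^ m"
  using assms
proof (induction m)
  case (Suc m)
  have "(\<Sum>k<m. d k * q ^ k) < q ^ m" using Suc by simp
  moreover have "(d m + 1) * q ^ m \<le> q * q ^ m"
    using Suc.prems[of m] by (intro mult_right_mono) auto
  ultimately show ?case by simp
qed simp

text \<open>Pairs \<open>x\<close>, \<open>\<tau> x\<close> are placed at opposite ends, from the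
  outside inwards; a fixed point, if there is one, ends up in the middle. Reversal of positions thus
  realises \<open>\<tau>\<close>, which turns the back diagonal into an algebraic condition.\<close>

lemma involution_enumeration:
  assumes "finite Z" and "\<And>x. x \<in> Z \<Longrightarrow> \<tau> x \<in> Z" and "\<And>x. x \<in> Z \<Longrightarrow> \<tau> (\<tau> x) = x"
    and "\<And>x y. x \<in> Z \<Longrightarrow> y \<in> Z \<Longrightarrow> \<tau> x = x \<Longrightarrow> \<tau> y = y \<Longrightarrow> x = y"
  shows "\<exists>\<rho>. bij_betw \<rho> {..<card Z} Z \<and> (\<forall>i<card Z. \<rho> (card Z - 1 - i) = \<tau> (\<rho> i))"
  using assms
proof (induction "card Z" arbitrary: Z rule: less_induct)
  case less
  show ?case
  proof (cases "\<exists>x\<in>Z. \<tau> x \<noteq> x")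
    case False
    then have "\<forall>x\<in>Z. \<forall>y\<in>Z. x = y" using less.prems(4) by blast
    then consider "Z = {}" | x where "Z = {x}" by blast
    then show ?thesis
    proof cases
      case (2 x)
      with False show ?thesis
        by (intro exI[of _ "\<lambda>_. x"]) (auto simp: bij_betw_def inj_on_def)
    qed (auto simp: bij_betw_def)
  next
    case True
    then obtain x where x: "x \<in> Z" "\<tau> x \<noteq> x" by blast
    define Y where "Y = Z - {x, \<tau> x}"
    define n where "n = card Y"
    have Z: "Z = insert x (insert (\<tau> x) Y)" "x \<notin> Y" "\<tau> x \<notin> Y" "finite Y"
      using x less.prems(1,2) by (auto simp: Y_def)
    have n: "card Z = Suc (Suc n)"
      using Z x by (simp add: n_def)
    have "\<exists>\<rho>. bij_betw \<rho> {..<n} Y \<and> (\<forall>i<n. \<rho> (n - 1 - i) = \<tau> (\<rho> i))"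
      unfolding n_def
    proof (rule less.hyps)
      show "card Y < card Z" using n by (simp add: n_def)
      show "\<tau> y \<in> Y" if "y \<in> Y" for y
        using that less.prems(2,3) x(1) unfolding Y_def by (metis Diff_iff empty_iff insert_iff)
      show "y = z" if "y \<in> Y" "z \<in> Y" "\<tau> y = y" "\<tau> z = z" for y z
        using less.prems(4) that by (simp add: Y_def)
      show "\<tau> (\<tau> y) = y" if "y \<in> Y" for y
        using less.prems(3) that by (simp add: Y_def)
    qed (use Z in simp)
    then obtain \<rho> where \<rho>: "bij_betw \<rho> {..<n} Y" "\<And>i. i < n \<Longrightarrow> \<rho> (n - 1 - i) = \<tau> (\<rho> i)"
      by blast
    define \<sigma> where "\<sigma> = (\<lambda>i. if i = 0 then x else if i = Suc n then \<tau> x else \<rho> (i - 1))"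
    have "bij_betw \<sigma> {0} {x}" "bij_betw \<sigma> {Suc n} {\<tau> x}"
      by (auto simp: \<sigma>_def bij_betw_def)
    moreover have "bij_betw \<sigma> {1..<Suc n} Y"
    proof -
      have "bij_betw (\<rho> \<circ> (\<lambda>i. i - 1)) {1..<Suc n} Y"
        by (rule bij_betw_trans[OF _ \<rho>(1)], rule bij_betw_byWitness[where f' = Suc]) auto
      then show ?thesis
        by (rule bij_betw_cong[THEN iffD1, rotated]) (auto simp: \<sigma>_def)
    qed
    ultimately have "bij_betw \<sigma> ({0} \<union> ({Suc n} \<union> {1..<Suc n})) ({x} \<union> ({\<tau> x} \<union> Y))"
      using Z x by (intro bij_betw_combine) auto
    moreover have "{0} \<union> ({Suc n} \<union> {1..<Suc n}) = {..<card Z}"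
      using n by auto
    moreover have "{x} \<union> ({\<tau> x} \<union> Y) = Z"
      using Z(1) by blast
    moreover have "\<sigma> (card Z - 1 - i) = \<tau> (\<sigma> i)" if i: "i < card Z" for i
    proof -
      consider "i = 0" | "i = Suc n" | j where "i = Suc j" "j < n"
        using i n by (cases i) (auto simp: less_Suc_eq)
      then show ?thesis
      proof cases
        case (3 j)
        then have "\<sigma> (card Z - 1 - i) = \<rho> (n - 1 - j)"
          using n by (auto simp: \<sigma>_def)
        with 3 show ?thesis using \<rho>(2)[of j] by (simp add: \<sigma>_def)
      qed (use n x less.prems(3) in \<open>simp_all add: \<sigma>_def\<close>)
    qed
    ultimately show ?thesis by metis
  qed
qed

section \<open>Polynomials of bounded degree\<close>

text \<open>Unlike \<open>degree p < k\<close>, this keeps the zero polynomial at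
  \<open>k = 0\<close>.\<close>

definition polys_below :: "nat \<Rightarrow> 'a::zero poly set" where
  "polys_below k = {p. \<forall>i\<ge>k. coeff p i = 0}"

lemma card_polys_below:
  "finite (polys_below k :: 'a::{finite,zero} poly set) \<and>
   card (polys_below k :: 'a poly set) = CARD('a) ^ k"
proof (induction k)
  case 0
  have "polys_below 0 = {0 :: 'a poly}"
    by (auto simp: polys_below_def poly_eq_iff)
  then show ?case by simp
next
  case (Suc k)
  have eq: "polys_below (Suc k) = (\<lambda>(a, p). pCons a p) ` (UNIV \<times> polys_below k :: ('a \<times> 'a poly) set)"
  proof (intro equalityI subsetI)
    fix p :: "'a poly" assume "p \<in> polys_below (Suc k)"
    then show "p \<in> (\<lambda>(a, p). pCons a p) ` (UNIV \<times> polys_below k)"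
      by (cases p) (force simp: polys_below_def coeff_pCons)
  qed (auto simp: polys_below_def coeff_pCons split: nat.split)
  have "inj_on (\<lambda>(a, p). pCons a p) (UNIV \<times> polys_below k :: ('a \<times> 'a poly) set)"
    by (auto simp: inj_on_def)
  with Suc show ?case
    by (simp add: eq card_image card_cartesian_product)
qed

lemma polys_below_diff: "p \<in> polys_below k \<Longrightarrow> r \<in> polys_below k \<Longrightarrow> p - r \<in> polys_below k"
  for p :: "'a::ab_group_add poly"
  by (simp add: polys_below_def)

lemma polys_below_mono: "k \<le> l \<Longrightarrow> polys_below k \<subseteq> polys_below l"
  by (auto simp: polys_below_def)

text \<open>Newton's scheme: a new point \<open>b\<close> is met by adding a multiple of the
  polynomial \<open>r\<close> that vanishes on the earlier points.\<close>

lemma interpolation: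
  fixes y :: "'a::field \<Rightarrow> 'a"
  assumes "finite S" "card S \<le> k"
  shows "\<exists>p\<in>polys_below k. \<forall>a\<in>S. poly p a = y a"
proof -
  have "\<exists>p\<in>polys_below (card S). \<forall>a\<in>S. poly p a = y a"
    using assms(1)
  proof (induction S rule: finite_induct)
    case empty
    show ?case by (auto simp: polys_below_def intro: exI[of _ 0])
  next
    case (insert b S)
    then obtain p where p: "p \<in> polys_below (card S)" "\<forall>a\<in>S. poly p a = y a" by blast
    define r where "r = (\<Prod>a\<in>S. [:- a, 1:])"
    have r: "poly r x = 0 \<longleftrightarrow> x \<in> S" for x
      using insert.hyps(1) by (auto simp: r_def poly_prod)
    have deg: "degree r = card S"
      unfolding r_def by (subst degree_prod_eq_sum_degree) auto
    let ?p = "p + smult ((y b - poly p b) / poly r b) r"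
    have "?p \<in> polys_below (card (insert b S))"
      using p(1) insert.hyps deg by (auto simp: polys_below_def coeff_eq_0)
    moreover have "\<forall>a\<in>insert b S. poly ?p a = y a"
      using p(2) r insert.hyps(2) by auto
    ultimately show ?case by blast
  qed
  with polys_below_mono[OF assms(2)] show ?thesis by blast
qed

section \<open>The codes and the square\<close>

definition coding_space :: "nat \<Rightarrow> ('a::zero poly \<times> 'a poly) set" where
  "coding_space t = polys_below t \<times> polys_below (t - 1)"

text \<open>
  The summand \<open>p(0)\<close> is needed because all field elements, in particular \<open>0\<close>, are evaluation
  points when \<open>q = 2t - 1\<close>, and \<open>X^t p\<close> alone would vanish there.
\<close>

definition shift_part :: "nat \<Rightarrow> 'a::comm_ring_1 poly \<Rightarrow> 'a poly" where
  "shift_part t p = monom 1 t * p + [:poly p 0:]"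

text \<open>The scalars form a 2 x 2 matrix acting on \<open>(u, w)\<close>; the flag in
  \<open>i\<close> selects its row. All four kinds of lines are instances.\<close>

definition code :: "nat \<Rightarrow> 'a \<Rightarrow> 'a \<Rightarrow> 'a \<Rightarrow> 'a \<Rightarrow> 'a::comm_ring_1 poly \<times> 'a poly \<Rightarrow> 'a \<times> bool \<Rightarrow> 'a" where
  "code t \<alpha> \<beta> \<gamma> \<delta> x i =
     (if snd i then \<alpha> * poly (fst x) (fst i) + \<gamma> * poly (shift_part t (snd x)) (fst i)
      else \<beta> * poly (fst x) (fst i) + \<delta> * poly (shift_part t (snd x)) (fst i))"

lemma poly_shift_part: "poly (shift_part t p) a = a ^ t * poly p a + poly p 0"
  by (simp add: shift_part_def poly_monom)

lemma card_coding_space: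
  assumes "t \<ge> 1"
  shows "finite (coding_space t :: ('a::{finite,zero} poly \<times> 'a poly) set)"
    and "card (coding_space t :: ('a poly \<times> 'a poly) set) = CARD('a) ^ (2 * t - 1)"
proof -
  have "t + (t - 1) = 2 * t - 1" using assms by simp
  then show "card (coding_space t :: ('a poly \<times> 'a poly) set) = CARD('a) ^ (2 * t - 1)"
    using card_polys_below[where 'a = 'a]
    by (simp add: coding_space_def card_cartesian_product flip: power_add)
  show "finite (coding_space t :: ('a poly \<times> 'a poly) set)"
    using card_polys_below[where 'a = 'a] by (simp add: coding_space_def)
qed

lemma coding_space_diff:
  fixes x y :: "'a::ab_group_add poly \<times> 'a poly"
  assumes "x \<in> coding_space t" "y \<in> coding_space t"
  shows "x - y \<in> coding_space t"
  using assms by (auto simp: coding_space_def polys_below_diff)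

lemma code_diff: "code t \<alpha> \<beta> \<gamma> \<delta> (x - y) i = code t \<alpha> \<beta> \<gamma> \<delta> x i - code t \<alpha> \<beta> \<gamma> \<delta> y i"
  by (simp add: code_def poly_shift_part algebra_simps)

lemma shift_part_interpolation:
  fixes y :: "'a::field \<Rightarrow> 'a"
  assumes B: "finite B" "2 * card B \<le> t" and t: "t \<ge> 3"
  shows "\<exists>p\<in>polys_below (t - 1). \<forall>a\<in>B. poly (shift_part t p) a = y a"
proof -
  \<comment> \<open>\<open>z\<close> becomes \<open>p(0)\<close>: it is forced when 0 is a
    prescribed point and free otherwise.\<close>
  define z where "z = (if 0 \<in> B then y 0 else 0)"
  \<comment> \<open>Fixing \<open>p(0)\<close> may cost one extra point; half of \<open>t\<close>,
    rounded down, plus 1 is at most \<open>t - 1\<close> because \<open>t \<ge> 3\<close>.\<close>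
  have "card (insert 0 B) \<le> t - 1"
    using card_insert_le_m1[of "t - 1" B 0] B t by (simp add: card_insert_if)
  then obtain p where p: "p \<in> polys_below (t - 1)"
    "\<forall>a\<in>insert 0 B. poly p a = (if a = 0 then z else (y a - z) / a ^ t)"
    using interpolation[of "insert 0 B" "t - 1" "\<lambda>a. if a = 0 then z else (y a - z) / a ^ t"] B by blast
  have "poly (shift_part t p) a = y a" if "a \<in> B" for a
    using p(2) that t by (auto simp: poly_shift_part z_def)
  with p(1) show ?thesis by blast
qed

lemma code_interpolation:
  fixes \<alpha> \<beta> \<gamma> \<delta> :: "'a::field"
  assumes nz: "\<alpha> \<noteq> 0" "\<beta> \<noteq> 0" "\<alpha> * \<delta> - \<beta> * \<gamma> \<noteq> 0"
    and K: "finite K" "card K \<le> t" and t: "t \<ge> 3"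
  shows "\<exists>x\<in>coding_space t. \<forall>i\<in>K. code t \<alpha> \<beta> \<gamma> \<delta> x i = y i"
proof -
  define S where "S = {a. (a, True) \<in> K}"
  define T where "T = {a. (a, False) \<in> K}"
  have KST: "K = S \<times> {True} \<union> T \<times> {False}"
    by (auto simp: S_def T_def) (metis (full_types))+
  have fin: "finite S" "finite T"
    using K(1) by (auto simp: S_def T_def intro!: finite_vimageI[of K "\<lambda>a. (a, _)", unfolded vimage_def] inj_onI)
  have "card K = card S + card T"
    using fin unfolding KST by (subst card_Un_disjoint) (auto simp: card_cartesian_product)
  \<comment> \<open>This single bound leaves at most \<open>t / 2\<close> points for
    \<open>w\<close> and at most \<open>t\<close> for \<open>u\<close>.\<close>
  then have card: "card (S \<union> T) + card (S \<inter> T) \<le> t"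
    using K(2) card_Un_Int[OF fin] by simp
  have "2 * card (S \<inter> T) \<le> t"
    using card card_mono[of "S \<union> T" "S \<inter> T"] fin by fastforce
  \<comment> \<open>Where both digits are prescribed, \<open>\<alpha>\<close> times the second
    equation minus \<open>\<beta>\<close> times the first eliminates \<open>u\<close>.\<close>
  then obtain p where p: "p \<in> polys_below (t - 1)" "\<forall>a\<in>S \<inter> T. poly (shift_part t p) a =
      (\<alpha> * y (a, False) - \<beta> * y (a, True)) / (\<alpha> * \<delta> - \<beta> * \<gamma>)"
    using shift_part_interpolation[of "S \<inter> T" t
      "\<lambda>a. (\<alpha> * y (a, False) - \<beta> * y (a, True)) / (\<alpha> * \<delta> - \<beta> * \<gamma>)"] fin t by blast
  define w where "w = poly (shift_part t p)"
  define z where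
    "z = (\<lambda>a. if a \<in> S then (y (a, True) - \<gamma> * w a) / \<alpha> else (y (a, False) - \<delta> * w a) / \<beta>)"
  obtain u where u: "u \<in> polys_below t" "\<forall>a\<in>S \<union> T. poly u a = z a"
    using interpolation[of "S \<union> T" t z] fin card by auto
  have "code t \<alpha> \<beta> \<gamma> \<delta> (u, p) (a, True) = y (a, True)" if "a \<in> S" for a
    using u(2) that nz by (simp add: code_def z_def flip: w_def)
  moreover have "code t \<alpha> \<beta> \<gamma> \<delta> (u, p) (a, False) = y (a, False)" if "a \<in> T" for a
  proof (cases "a \<in> S")
    case True
    then have w: "w a * (\<alpha> * \<delta> - \<beta> * \<gamma>) = \<alpha> * y (a, False) - \<beta> * y (a, True)"
      using p(2) that nz by (simp add: w_def)
    \<comment> \<open>Here \<open>u\<close> was chosen from the first equation; the choice of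
      \<open>w\<close> makes the second one hold as well.\<close>
    have "\<alpha> * (\<beta> * ((y (a, True) - \<gamma> * w a) / \<alpha>) + \<delta> * w a) = \<alpha> * y (a, False)"
      using nz w by (simp add: field_simps)
    then show ?thesis
      using u(2) True nz by (simp add: code_def z_def flip: w_def)
  next
    case False
    then show ?thesis
      using u(2) that nz by (simp add: code_def z_def flip: w_def)
  qed
  ultimately have "\<forall>i\<in>K. code t \<alpha> \<beta> \<gamma> \<delta> (u, p) i = y i"
    unfolding KST by auto
  with u p show ?thesis by (auto simp: coding_space_def)
qed

lemma orthogonal_array_code:
  fixes \<alpha> \<beta> \<gamma> \<delta> :: "'a::field"
  assumes "\<alpha> \<noteq> 0" "\<beta> \<noteq> 0" "\<alpha> * \<delta> - \<beta> * \<gamma> \<noteq> 0" "finite I" "t \<ge> 3"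
    and "\<And>x i. D x i = code t \<alpha> \<beta> \<gamma> \<delta> x i + b i"
  shows "orthogonal_array t I (coding_space t) D"
proof (rule orthogonal_array_affine[where L = "code t \<alpha> \<beta> \<gamma> \<delta>" and b = b])
  \<comment> \<open>Finiteness of \<open>I\<close> rules out an infinite \<open>K\<close>, whose
    \<open>card\<close> would be 0.\<close>
  show "\<exists>x\<in>coding_space t. \<forall>i\<in>K. code t \<alpha> \<beta> \<gamma> \<delta> x i = y i" if "K \<subseteq> I" "card K \<le> t" for K y
    using assms that finite_subset by (intro code_interpolation) blast+
qed (use assms in \<open>simp_all add: coding_space_diff code_diff\<close>)

text \<open>An interpolating \<open>P\<close> of degree below \<open>2 * t - 1\<close> is cut at
  exponent \<open>t\<close>: the upper coefficients form \<open>p\<close>, and \<open>u\<close> is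
  the lower part corrected by the constant \<open>p(0)\<close>.\<close>

lemma polynomial_split:
  fixes f :: "'a::field \<Rightarrow> 'a"
  assumes A: "finite A" "card A \<le> 2 * t - 1" and t: "t \<ge> 1"
  shows "\<exists>(u, p)\<in>coding_space t. \<forall>a\<in>A. poly u a + poly (shift_part t p) a = f a"
proof -
  obtain P where P: "P \<in> polys_below (2 * t - 1)" "\<forall>a\<in>A. poly P a = f a"
    using interpolation[OF A] by blast
  define p where "p = poly_shift t P"
  define u where "u = P - shift_part t p"
  have "p \<in> polys_below (t - 1)"
    using P(1) t by (auto simp: polys_below_def p_def coeff_poly_shift)
  moreover have "u \<in> polys_below t"
    using t by (auto simp: polys_below_def u_def p_def shift_part_def coeff_monom_mult
        coeff_poly_shift coeff_pCons split: nat.split)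
  moreover have "\<forall>a\<in>A. poly u a + poly (shift_part t p) a = f a"
    using P(2) by (simp add: u_def)
  ultimately show ?thesis by (auto simp: coding_space_def)
qed

text \<open>This yields every digit string, hence every entry value. Each digit block contains the
  \<open>w\<close> of only one of \<open>r\<close>, \<open>c\<close>, so \<open>p1\<close> and
  \<open>p2\<close> can be met separately; the two \<open>u\<close> parts then solve a linear system
  of determinant \<open>1 - \<mu> * \<mu>\<close>, inverted by \<open>\<kappa>\<close>.\<close>

lemma code_pair_surj:
  fixes \<mu> :: "'a::field"
  assumes A: "finite A" "card A \<le> 2 * t - 1" and t: "t \<ge> 1"
    and \<mu>: "\<mu> \<noteq> 0" "\<mu> * \<mu> \<noteq> 1"
  shows "\<exists>r\<in>coding_space t. \<exists>c\<in>coding_space t. \<forall>i\<in>A \<times> UNIV.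
           code t \<mu> 1 0 \<mu> r i + code t 1 \<mu> 1 0 c i = y i"
proof -
  obtain u1 p1 where 1: "u1 \<in> polys_below t" "p1 \<in> polys_below (t - 1)"
    "\<forall>a\<in>A. poly u1 a + poly (shift_part t p1) a = y (a, True)"
    using polynomial_split[OF A t, of "\<lambda>a. y (a, True)"] by (auto simp: coding_space_def)
  obtain u2 p2 where 2: "u2 \<in> polys_below t" "p2 \<in> polys_below (t - 1)"
    "\<forall>a\<in>A. poly u2 a + poly (shift_part t p2) a = y (a, False)"
    using polynomial_split[OF A t, of "\<lambda>a. y (a, False)"] by (auto simp: coding_space_def)
  define \<kappa> where "\<kappa> = inverse (1 - \<mu> * \<mu>)"
  have \<kappa>: "\<kappa> * (1 - \<mu> * \<mu>) = 1"
    using \<mu> by (simp add: \<kappa>_def)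
  define c where "c = (smult \<kappa> (u1 - smult \<mu> u2), p1)"
  define r where "r = (smult \<kappa> (u2 - smult \<mu> u1), smult (inverse \<mu>) p2)"
  have mem: "c \<in> coding_space t" "r \<in> coding_space t"
    using 1 2 by (auto simp: c_def r_def coding_space_def polys_below_def)
  have "code t \<mu> 1 0 \<mu> r (a, b) + code t 1 \<mu> 1 0 c (a, b) = y (a, b)" if "a \<in> A" for a b
  proof (cases b)
    case True
    have "code t \<mu> 1 0 \<mu> r (a, b) + code t 1 \<mu> 1 0 c (a, b) =
        \<kappa> * (1 - \<mu> * \<mu>) * poly u1 a + poly (shift_part t p1) a"
      using True by (simp add: code_def r_def c_def algebra_simps)
    then show ?thesis using 1(3) that True \<kappa> by simp
  next
    case False
    have "\<mu> * poly (shift_part t (smult (inverse \<mu>) p2)) a = poly (shift_part t p2) a"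
      using \<mu> by (simp add: poly_shift_part field_simps)
    then have "code t \<mu> 1 0 \<mu> r (a, b) + code t 1 \<mu> 1 0 c (a, b) =
        \<kappa> * (1 - \<mu> * \<mu>) * poly u2 a + poly (shift_part t p2) a"
      using False by (simp add: code_def r_def c_def algebra_simps)
    then show ?thesis using 2(3) that False \<kappa> by simp
  qed
  with mem show ?thesis by blast
qed

text \<open>
  The reflection of indices becomes \<open>x \<mapsto> v - x\<close>. It has one fixed point for odd and none for
  even order, which forces \<open>v \<noteq> 0\<close> in characteristic two.
\<close>

lemma coding_space_enumeration:
  assumes t: "t \<ge> 1"
  shows "\<exists>\<rho> v. v \<in> coding_space t \<and>
           bij_betw \<rho> {..<CARD('a) ^ (2 * t - 1)} (coding_space t :: ('a::{finite,field} poly \<times> 'a poly) set) \<and>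
           (\<forall>i<CARD('a) ^ (2 * t - 1). \<rho> (CARD('a) ^ (2 * t - 1) - 1 - i) = v - \<rho> i)"
proof -
  define v :: "'a poly \<times> 'a poly" where "v = (if (2 :: 'a) = 0 then (1, 0) else 0)"
  have v: "v \<in> coding_space t"
    using t by (auto simp: v_def coding_space_def polys_below_def zero_prod_def)
  have fixpoint: "x = y" if "v - x = x" "v - y = y" for x y
  proof (cases "(2 :: 'a) = 0")
    case True
    \<comment> \<open>In characteristic two a fixed point would force \<open>1 = 0\<close>, so there
      is none.\<close>
    have "poly (fst (v - x)) 0 = poly (fst x) 0" using that(1) by simp
    then have "1 = 2 * poly (fst x) 0"
      using True by (simp add: v_def)
    with True show ?thesis by simp
  next
    case False
    have zero: "f = 0" if "- f = f" for f :: "'a poly"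
    proof (rule poly_eqI)
      fix n
      have "- coeff f n = coeff f n" by (metis coeff_minus that)
      then have "2 * coeff f n = 0" by (metis add.right_inverse mult_2)
      with False show "coeff f n = coeff 0 n" by simp
    qed
    have "- fst x = fst x" "- snd x = snd x" "- fst y = fst y" "- snd y = snd y"
      using that False by (simp_all add: v_def prod_eq_iff)
    then show ?thesis by (metis zero prod_eqI)
  qed
  have "\<exists>\<rho>. bij_betw \<rho> {..<card (coding_space t :: ('a poly \<times> 'a poly) set)} (coding_space t) \<and>
      (\<forall>i<card (coding_space t :: ('a poly \<times> 'a poly) set).
         \<rho> (card (coding_space t :: ('a poly \<times> 'a poly) set) - 1 - i) = v - \<rho> i)"
    using card_coding_space(1)[OF t, where 'a = 'a] v fixpoint
    by (intro involution_enumeration[where \<tau> = "\<lambda>x. v - x"]) (auto intro: coding_space_diff)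
  with v show ?thesis
    unfolding card_coding_space(2)[OF t, where 'a = 'a] by blast
qed

lemma base_expansion_surj:
  fixes \<phi> :: "'a \<Rightarrow> nat"
  assumes \<phi>: "bij_betw \<phi> UNIV {..<q}" and ord: "bij_betw ord I {..<m}" and x: "x < q ^ m"
  shows "\<exists>y. (\<Sum>i\<in>I. \<phi> (y i) * q ^ ord i) = x"
proof -
  have "q > 0" using \<phi> by (auto simp: bij_betw_def intro: gr0I)
  then have dig: "\<phi> (inv_into UNIV \<phi> (k mod q)) = k mod q" for k
    using \<phi> by (intro f_inv_into_f) (auto simp: bij_betw_def)
  have "(\<Sum>i\<in>I. \<phi> (inv_into UNIV \<phi> (x div q ^ ord i mod q)) * q ^ ord i) =
      (\<Sum>k<m. (x div q ^ k mod q) * q ^ k)"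
    unfolding dig by (rule sum.reindex_bij_betw[OF ord])
  with x show ?thesis by (auto simp: sum_digits_mod)
qed

lemma base_expansion_less:
  fixes \<phi> :: "'a \<Rightarrow> nat"
  assumes \<phi>: "\<And>a. \<phi> a < q" and ord: "bij_betw ord I {..<m}"
  shows "(\<Sum>i\<in>I. \<phi> (y i) * q ^ ord i) < q ^ m"
proof -
  have "(\<Sum>i\<in>I. \<phi> (y i) * q ^ ord i) = (\<Sum>k<m. \<phi> (y (inv_into I ord k)) * q ^ k)"
    using ord by (subst sum.reindex_bij_betw[OF ord, symmetric])
      (auto intro!: sum.cong simp: bij_betw_def inv_into_f_f)
  with \<phi> show ?thesis by (simp add: sum_digits_less)
qed

theorem multimagic_square_from_finite_field:
  assumes t: "t \<ge> 3" and q: "CARD('a::{finite,field}) \<ge> 2 * t - 1"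
  shows "\<exists>M. multimagic_square (CARD('a) ^ (2 * t - 1)) t M"
proof -
  define q where "q = CARD('a)"
  define N where "N = q ^ (2 * t - 1)"
  define V where "V = (coding_space t :: ('a poly \<times> 'a poly) set)"
  \<comment> \<open>The field has at least 5 elements, which leaves a \<open>\<mu>\<close> avoiding
    the zeros of every determinant below.\<close>
  have "card {0, 1, -1 :: 'a} < CARD('a)"
    using q t by (intro le_less_trans[OF card_insert_le_m1[of 3]]) (auto simp: card_insert_if)
  then obtain \<mu> :: 'a where "\<mu> \<notin> {0, 1, -1}"
    by (metis UNIV_eq_I less_irrefl)
  then have \<mu>: "\<mu> \<noteq> 0" "\<mu> \<noteq> 1" "1 + \<mu> \<noteq> 0" "\<mu> * \<mu> \<noteq> 1"
    by (auto simp: eq_neg_iff_add_eq_0 add.commute square_eq_1_iff)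
  obtain A :: "'a set" where A: "finite A" "card A = 2 * t - 1"
    using obtain_subset_with_card_n[OF q] by (metis finite)
  define I where "I = A \<times> (UNIV :: bool set)"
  have I: "finite I" "card I = 2 * (2 * t - 1)"
    using A by (simp_all add: I_def card_cartesian_product)
  obtain ord where ord: "bij_betw ord I {..<2 * (2 * t - 1)}"
    using ex_bij_betw_finite_nat[OF I(1)] I(2) by (auto simp: atLeast0LessThan)
  obtain \<phi> where \<phi>: "bij_betw \<phi> (UNIV :: 'a set) {..<q}"
    using ex_bij_betw_finite_nat[of "UNIV :: 'a set"] by (auto simp: atLeast0LessThan q_def)
  obtain \<rho> v where v: "v \<in> V" and \<rho>: "bij_betw \<rho> {..<N} V"
    and rev: "\<And>i. i < N \<Longrightarrow> \<rho> (N - 1 - i) = v - \<rho> i"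
    using coding_space_enumeration[of t, where 'a = 'a] t unfolding V_def N_def q_def by auto
  have V: "finite V"
    using card_coding_space(1)[of t, where 'a = 'a] t by (simp add: V_def)
  define D where "D = (\<lambda>r c i. code t \<mu> 1 0 \<mu> r i + code t 1 \<mu> 1 0 c i)"
  define h where "h = (\<lambda>i a. int (\<phi> a * q ^ ord i))"
  define M where "M = (\<lambda>i j. \<Sum>k\<in>I. h k (D (\<rho> i) (\<rho> j) k))"
  \<comment> \<open>The determinants for rows, columns, diagonal and back diagonal are
    \<open>- \<mu>\<close>, \<open>\<mu> * \<mu>\<close>, \<open>(1 + \<mu>) * (\<mu> - 1)\<close>
    and \<open>(\<mu> - 1) * (\<mu> - 1)\<close>. A fixed row or column, or \<open>v\<close>,
    contributes only constants.\<close>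
  have row: "orthogonal_array t I V (\<lambda>c. D r c)" for r
    unfolding V_def using \<mu> I t
    by (intro orthogonal_array_code[of 1 \<mu> 0 1 _ _ _ "code t \<mu> 1 0 \<mu> r"]) (auto simp: D_def)
  have column: "orthogonal_array t I V (\<lambda>r. D r c)" for c
    unfolding V_def using \<mu> I t
    by (intro orthogonal_array_code[of \<mu> 1 \<mu> 0 _ _ _ "code t 1 \<mu> 1 0 c"]) (auto simp: D_def)
  have diagonal: "orthogonal_array t I V (\<lambda>x. D x x)"
    unfolding V_def
  proof (rule orthogonal_array_code[of "1 + \<mu>" "1 + \<mu>" \<mu> 1 _ _ _ "\<lambda>_. 0"])
    have "(1 + \<mu>) * \<mu> - (1 + \<mu>) * 1 = (1 + \<mu>) * (\<mu> - 1)" by (simp add: algebra_simps)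
    then show "(1 + \<mu>) * \<mu> - (1 + \<mu>) * 1 \<noteq> 0" using \<mu> by simp
  qed (use \<mu> I t in \<open>auto simp: D_def code_def algebra_simps\<close>)
  have back_diagonal: "orthogonal_array t I V (\<lambda>x. D x (v - x))"
    unfolding V_def
  proof (rule orthogonal_array_code[of "\<mu> - 1" "1 - \<mu>" \<mu> "- 1" _ _ _ "code t 1 \<mu> 1 0 v"])
    have "(\<mu> - 1) * \<mu> - (1 - \<mu>) * - 1 = (\<mu> - 1) * (\<mu> - 1)" by (simp add: algebra_simps)
    then show "(\<mu> - 1) * \<mu> - (1 - \<mu>) * - 1 \<noteq> 0" using \<mu> by simp
  qed (use \<mu> I t in \<open>auto simp: D_def code_def poly_shift_part algebra_simps\<close>)
  have reindex: "(\<Sum>i<N. F (\<rho> i)) = (\<Sum>x\<in>V. F x)" for F :: "_ \<Rightarrow> int"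
    by (rule sum.reindex_bij_betw[OF \<rho>])
  have "general_multimagic N t M"
    unfolding general_multimagic_def general_magic_square_def
  proof (intro ballI exI conjI allI impI)
    fix e assume e: "e \<in> {1..t}"
    \<comment> \<open>The array of the row vector 0 serves as the reference for all lines.\<close>
    let ?s = "\<Sum>x\<in>V. (\<Sum>k\<in>I. h k (D 0 x k)) ^ e"
    have moments: "(\<Sum>x\<in>V. (\<Sum>k\<in>I. h k (E x k)) ^ e) = ?s" if "orthogonal_array t I V E" for E
      using e V I by (intro moments_orthogonal_array_eq[OF that row[of 0]]) auto
    show "(\<Sum>j<N. M i j ^ e) = ?s" for i
      using moments[OF row] unfolding M_def reindex[of "\<lambda>x. (\<Sum>k\<in>I. h k (D (\<rho> i) x k)) ^ e"] .
    show "(\<Sum>i<N. M i j ^ e) = ?s" for j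
      using moments[OF column] unfolding M_def reindex[of "\<lambda>x. (\<Sum>k\<in>I. h k (D x (\<rho> j) k)) ^ e"] .
    show "(\<Sum>i<N. M i i ^ e) = ?s"
      using moments[OF diagonal] unfolding M_def reindex[of "\<lambda>x. (\<Sum>k\<in>I. h k (D x x k)) ^ e"] .
    have "(\<Sum>i<N. M i (N - 1 - i) ^ e) = (\<Sum>i<N. (\<Sum>k\<in>I. h k (D (\<rho> i) (v - \<rho> i) k)) ^ e)"
      using rev by (intro sum.cong) (auto simp: M_def)
    then show "(\<Sum>i<N. M i (N - 1 - i) ^ e) = ?s"
      using moments[OF back_diagonal] unfolding reindex[of "\<lambda>x. (\<Sum>k\<in>I. h k (D x (v - x) k)) ^ e"] by simp
  qed
  \<comment> \<open>Base-\<open>q\<close> numbers start at 0, so \<open>a = 0\<close>; it remains to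
    bound the entries and to reach every value.\<close>
  moreover have "(\<lambda>(i, j). M i j) ` ({..<N} \<times> {..<N}) = {0..0 + int (N ^ 2) - 1}"
  proof -
    have N2: "N ^ 2 = q ^ (2 * (2 * t - 1))"
      unfolding N_def by (metis power_mult mult.commute)
    have M: "M i j = int (\<Sum>k\<in>I. \<phi> (D (\<rho> i) (\<rho> j) k) * q ^ ord k)" for i j
      by (simp add: M_def h_def)
    have range: "int m \<in> {0..0 + int n - 1}" if "m < n" for m n
      using that by auto
    have "\<phi> a < q" for a
      using \<phi> by (auto simp: bij_betw_def)
    then have "(\<Sum>k\<in>I. \<phi> (D (\<rho> i) (\<rho> j) k) * q ^ ord k) < N ^ 2" for i j
      unfolding N2 by (intro base_expansion_less[OF _ ord])
    then have "M i j \<in> {0..0 + int (N ^ 2) - 1}" for i j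
      unfolding M by (rule range)
    moreover have "\<exists>i<N. \<exists>j<N. M i j = z" if "z \<in> {0..0 + int (N ^ 2) - 1}" for z
    proof -
      have "nat z < q ^ (2 * (2 * t - 1))"
        using that unfolding N2[symmetric] by (auto simp: nat_less_iff)
      then obtain y where y: "(\<Sum>i\<in>I. \<phi> (y i) * q ^ ord i) = nat z"
        using base_expansion_surj[OF \<phi> ord] by blast
      obtain r c where rc: "r \<in> V" "c \<in> V" "\<forall>i\<in>I. D r c i = y i"
        using code_pair_surj[of A t \<mu> y] A t \<mu> unfolding V_def I_def D_def by auto
      obtain i j where "i < N" "j < N" "\<rho> i = r" "\<rho> j = c"
        using \<rho> rc(1,2) by (metis bij_betw_def imageE lessThan_iff)
      moreover from this have "M i j = z"
        using rc(3) y that unfolding M by simp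
      ultimately show ?thesis by blast
    qed
    ultimately show ?thesis by fastforce
  qed
  ultimately show ?thesis
    unfolding multimagic_square_def N_def q_def by blast
qed

section \<open>Fixed points of the Frobenius map\<close>

text \<open>\<open>p\<close> splits into linear factors, and a repeated factor would give a common
  root with the derivative.\<close>

lemma card_roots_separable:
  fixes p :: "'a::alg_closed_field poly"
  assumes p: "p \<noteq> 0" and sep: "\<And>a. poly p a = 0 \<Longrightarrow> poly (pderiv p) a \<noteq> 0"
  shows "card {a. poly p a = 0} = degree p"
proof -
  obtain A where A: "size A = degree p" "p = smult (lead_coeff p) (\<Prod>x\<in>#A. [:- x, 1:])"
    using alg_closed_imp_factorization[OF p] by blast
  have root: "poly p a = 0 \<longleftrightarrow> a \<in># A" for a
    by (subst A(2)) (use p in \<open>auto simp: poly_prod_mset prod_mset_zero_iff\<close>)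
  have "count A a = 1" if "a \<in># A" for a
  proof (rule ccontr)
    assume "count A a \<noteq> 1"
    with that obtain B where B: "A = add_mset a B" "a \<in># B"
      by (metis One_nat_def count_add_mset count_eq_zero_iff mset_add)
    then obtain C where C: "A = add_mset a (add_mset a C)"
      by (metis mset_add)
    have "p = [:- a, 1:] * ([:- a, 1:] * smult (lead_coeff p) (\<Prod>x\<in>#C. [:- x, 1:]))"
      by (subst A(2)) (simp add: C)
    then obtain r where "p = [:- a, 1:] * ([:- a, 1:] * r)" by blast
    then have "poly (pderiv p) a = 0"
      by (simp add: pderiv_mult del: mult_pCons_left mult_pCons_right)
    with sep root that show False by blast
  qed
  then have "size A = card (set_mset A)"
    by (simp add: size_multiset_overloaded_eq)
  with A(1) root show ?thesis by simp
qed

text \<open>The polynomial \<open>X^q - X\<close> is separable: \<open>q\<close> vanishes in the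
  field, so the derivative is \<open>- 1\<close>.\<close>

lemma card_frobenius_fixpoints:
  assumes q: "q = CHAR('a::alg_closed_field) ^ k" and k: "k \<ge> 1" and prime: "prime CHAR('a)"
  shows "card {x::'a. x ^ q = x} = q"
proof -
  have q1: "q > 1"
    using q k prime prime_gt_1_nat by (metis one_less_power less_le_trans zero_less_one)
  define p :: "'a poly" where "p = monom 1 q - monom 1 1"
  have deg: "degree p = q"
    unfolding p_def diff_conv_add_uminus using q1
    by (subst degree_add_eq_left) (auto simp: degree_monom_eq)
  have "of_nat q = (0 :: 'a)"
    using k by (simp add: q of_nat_eq_0_iff_char_dvd)
  then have "pderiv p = - 1"
    by (simp add: p_def pderiv_diff pderiv_monom monom_0 one_pCons)
  moreover have "p \<noteq> 0" using deg q1 by auto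
  ultimately have "card {x. poly p x = 0} = q"
    using card_roots_separable[of p] deg by simp
  moreover have "poly p x = x ^ q - x" for x
    by (simp add: p_def poly_monom)
  ultimately show ?thesis by simp
qed

section \<open>A field with a given prime power of elements\<close>

text \<open>
  A type cannot depend on the variable \<open>q\<close>. Instead a single prime power is chosen that refutes
  the theorem if any prime power does; the field is then built for this constant only.
\<close>

definition admissible_order :: "nat \<Rightarrow> bool" where
  "admissible_order q \<longleftrightarrow> (\<forall>t\<ge>3. q \<ge> 2 * t - 1 \<longrightarrow> (\<exists>M. multimagic_square (q ^ (2 * t - 1)) t M))"

definition critical_order :: nat where
  "critical_order =
     (SOME q. prime_power q \<and>
        ((\<exists>q'. prime_power q' \<and> \<not> admissible_order q') \<longrightarrow> \<not> admissible_order q))"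

lemma prime_power_critical_order: "prime_power critical_order"
  and critical_order: "prime_power q \<Longrightarrow> admissible_order critical_order \<Longrightarrow> admissible_order q"
proof -
  \<comment> \<open>Any prime power serves as the choice when no counterexample exists.\<close>
  have "prime_power 2"
    unfolding prime_power_def by (intro exI[of _ 2] exI[of _ 1]) auto
  then have "\<exists>q. prime_power q \<and>
      ((\<exists>q'. prime_power q' \<and> \<not> admissible_order q') \<longrightarrow> \<not> admissible_order q)"
    by blast
  from someI_ex[OF this] show "prime_power critical_order"
    and "prime_power q \<Longrightarrow> admissible_order critical_order \<Longrightarrow> admissible_order q"
    unfolding critical_order_def by blast+
qed

definition critical_char :: nat where
  "critical_char = (SOME p. prime p \<and> (\<exists>k\<ge>1. critical_order = p ^ k))"

lemma prime_critical_char: "prime critical_char"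
  and critical_order_eq: "\<exists>k\<ge>1. critical_order = critical_char ^ k"
  using someI_ex[of "\<lambda>p. prime p \<and> (\<exists>k\<ge>1. critical_order = p ^ k)"] prime_power_critical_order
  unfolding critical_char_def prime_power_def by blast+

text \<open>A type of prime cardinality, over which \<open>mod_ring\<close> is the prime
  field.\<close>

typedef critical_residue = "{..<critical_char}"
  using prime_gt_0_nat[OF prime_critical_char] by auto

lemma CARD_critical_residue: "CARD(critical_residue) = critical_char"
  using type_definition.card[OF type_definition_critical_residue] by simp

instance critical_residue :: prime_card
  by standard (simp add: CARD_critical_residue prime_critical_char)

lemma critical_freshmans_dream:
  fixes x y :: "critical_residue mod_ring alg_closure"
  shows "(x + y) ^ critical_order = x ^ critical_order + y ^ critical_order"
  using critical_order_eq
  by (auto intro!: freshmans_dream' simp: CARD_critical_residue prime_critical_char)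

lemma critical_order_pos: "critical_order > 0"
  using critical_order_eq prime_gt_0_nat[OF prime_critical_char] by (metis zero_less_power)

text \<open>The Frobenius fixed points in the algebraic closure of the prime field form its subfield
  of order \<open>critical_order\<close>.\<close>

typedef critical_field = "{x :: critical_residue mod_ring alg_closure. x ^ critical_order = x}"
  by (rule exI[of _ 1]) simp

setup_lifting type_definition_critical_field

instantiation critical_field :: field
begin

lift_definition zero_critical_field :: critical_field is 0
  using critical_order_pos by simp

lift_definition one_critical_field :: critical_field is 1
  by simp

lift_definition plus_critical_field :: "critical_field \<Rightarrow> critical_field \<Rightarrow> critical_field" is "(+)"
  by (simp add: critical_freshmans_dream)

lift_definition uminus_critical_field :: "critical_field \<Rightarrow> critical_field" is uminus
proof -
  fix x :: "critical_residue mod_ring alg_closure"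
  assume "x ^ critical_order = x"
  \<comment> \<open>Additivity of the power at \<open>x\<close> and \<open>- x\<close> covers odd
    and even characteristic alike.\<close>
  then have "x + (- x) ^ critical_order = 0"
    using critical_freshmans_dream[of x "- x"] critical_order_pos by (simp add: zero_power)
  then show "(- x) ^ critical_order = - x"
    by (simp add: add_eq_0_iff)
qed

lift_definition times_critical_field :: "critical_field \<Rightarrow> critical_field \<Rightarrow> critical_field" is "(*)"
  by (simp add: power_mult_distrib)

lift_definition inverse_critical_field :: "critical_field \<Rightarrow> critical_field" is inverse
  by (simp add: power_inverse)

definition "x - y = x + - (y :: critical_field)"

definition "x div y = x * inverse (y :: critical_field)"

instance
proof
  fix a b c :: critical_field
  show "a * b * c = a * (b * c)" "a * b = b * a" "1 * a = a" "(a + b) * c = a * c + b * c"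
    "a + b + c = a + (b + c)" "a + b = b + a" "0 + a = a" "- a + a = 0"
    "(0 :: critical_field) \<noteq> 1" "inverse (0 :: critical_field) = 0"
    by (transfer; simp add: algebra_simps)+
  show "a \<noteq> 0 \<Longrightarrow> inverse a * a = 1"
    by transfer simp
qed (simp_all add: minus_critical_field_def divide_critical_field_def)

end

lemma card_critical_field_set:
  "card {x :: critical_residue mod_ring alg_closure. x ^ critical_order = x} = critical_order"
  using critical_order_eq
  by (auto intro!: card_frobenius_fixpoints simp: CARD_critical_residue prime_critical_char)

lemma CARD_critical_field: "CARD(critical_field) = critical_order"
  using type_definition.card[OF type_definition_critical_field] card_critical_field_set by simp

text \<open>An infinite type would have \<open>CARD\<close> equal to 0.\<close>

instance critical_field :: finite
  by standard (use CARD_critical_field critical_order_pos card_ge_0_finite in metis)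

theorem theorem1p2:
  fixes t q :: nat
  assumes "t \<ge> 3" and "prime_power q" and "q \<ge> 2 * t - 1"
  shows "\<exists>M. multimagic_square (q ^ (2 * t - 1)) t M"
proof -
  \<comment> \<open>One field suffices: the choice of \<open>critical_order\<close> carries the
    result over to \<open>q\<close>.\<close>
  have "admissible_order critical_order"
    unfolding admissible_order_def
    using multimagic_square_from_finite_field[where 'a = critical_field]
    by (simp add: CARD_critical_field)
  then show ?thesis
    using critical_order[OF assms(2)] assms(1,3) by (simp add: admissible_order_def)
qed

end
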